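(* Let $b\ge2$ and $n,r,s,t\ge0$ be integers with $0\le s,t\le b-1$, let $c$ be a positive multiple of $b$, and let $l\ge0$ be an integer. Then $$T_{bc,l}^{(b)}(bn+s,br+t;q)\equiv(-1)^tq^{\binom{t}{2}}\begin{bmatrix} s\\ t\end{bmatrix}_{q}\,T_{c,l}^{(b)}(n,r;q^b)\pmod{\Phi_b(q)}.$$
   Context: $[m]_q=\frac{1-q^m}{1-q}$, $[m]_q!=[m]_q[m-1]_q\cdots[1]_q$ ($[0]_q!=1$). For integers $m$ and $k>0$, $\begin{bmatrix} m\\ k\end{bmatrix}_q=\frac{[m]_q\cdots[m-k+1]_q}{[k]_q\cdots[1]_q}$, $\begin{bmatrix} m\\ 0\end{bmatrix}_q=1$, $\begin{bmatrix} m\\ k\end{bmatrix}_q=0$ for $k<0$. $\Phi_d$ is the $d$-th cyclotomic polynomial. For positive integers $b\mid c$, integers $l,n\ge0$ and $r$, define $$T_{c,l}^{(b)}(n,r;q)=\frac{[l]_{q^{c}}!\,\Phi_c(q)^l}{[\lfloor nb/c\rfloor]_{q^{c/b}}!}\sum_{\substack{k\in\mathbb{Z}\\k\equiv r\pmod{c}}}(-1)^kq^{\binom{k}{2}}\begin{bmatrix} n\\ k\end{bmatrix}_{q}\begin{bmatrix} (k-r)/c\\ l\end{bmatrix}_{q^{c}},$$ and $T_{c,l}^{(b)}(n,r;q^b)$ denotes this expression with $q$ replaced by $q^b$ everywhere (including in $\Phi_c$). For rational functions $A,B$ in $q$ and $m\ge1$, $A\equiv B\pmod{\Phi_b(q)^m}$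 means $A-B=\Phi_b(q)^m\,U/V$ with $U\in\mathbb{Q}[q,q^{-1}]$ and $V\in\mathbb{Q}[q]$ a nonzero polynomial not divisible by $\Phi_b(q)$. *)

theory Defs
  imports
    "HOL-Computational_Algebra.Computational_Algebra"
    "HOL-Library.Groups_Big_Fun"
begin

text \<open>
  The quantities \<open>[m]_q\<close>, \<open>[m]_q!\<close>, the \<open>q\<close>-binomial coefficient and \<open>T\<close> are defined for an
  arbitrary element \<open>x\<close> of a field in place of \<open>q\<close>.  Replacing \<open>q\<close> by \<open>q ^ b\<close> is then
  instantiation of \<open>x\<close>; the intended field is \<open>rat poly fract\<close>, i.e. the field of rational
  functions in \<open>q\<close> over the rationals.
\<close>

definition qnum :: "'a::field \<Rightarrow> int \<Rightarrow> 'a" where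
  "qnum x m = (1 - x powi m) / (1 - x)"

definition qfact :: "'a::field \<Rightarrow> nat \<Rightarrow> 'a" where
  "qfact x m = (\<Prod>i = 1..m. qnum x (int i))"

text \<open>The top argument may be any integer; for \<open>k = 0\<close> both products are empty.\<close>

definition qbinom :: "'a::field \<Rightarrow> int \<Rightarrow> int \<Rightarrow> 'a" where
  "qbinom x m k =
     (if k < 0 then 0
      else (\<Prod>i<nat k. qnum x (m - int i)) / (\<Prod>i = 1..nat k. qnum x (int i)))"

definition primitive_roots :: "nat \<Rightarrow> complex set" where
  "primitive_roots d = {z. z ^ d = 1 \<and> (\<forall>m. 0 < m \<and> m < d \<longrightarrow> z ^ m \<noteq> 1)}"

text \<open>
  The cyclotomic polynomial as an element of \<open>\<int>[X]\<close>, so that it can be evaluated in any ring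
  via \<^const>\<open>of_int\<close>.  That the description is proper for \<open>d > 0\<close> is \<open>of_int_cyclotomic\<close> below.
\<close>

definition cyclotomic :: "nat \<Rightarrow> int poly" where
  "cyclotomic d = (THE p. map_poly of_int p = (\<Prod>z\<in>primitive_roots d. [:- z, 1:]))"

text \<open>
  \<open>qsumT b c l n r x\<close> is \<open>T\<^sub>c\<^sub>,\<^sub>l\<^sup>(\<^sup>b\<^sup>)(n, r; x)\<close>, meaningful for \<open>b > 0\<close> and \<open>b dvd c\<close>.
  All terms of the sum with \<open>k < 0\<close> or \<open>k > n\<close> vanish, see \<open>qsumT_finite_sum\<close>;
  \<^const>\<open>Sum_any\<close> is the sum of a finitely supported function over the whole type,
  here \<^typ>\<open>int\<close>.  Both divisions of integers in the summand are exact.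
\<close>

definition qsumT :: "nat \<Rightarrow> nat \<Rightarrow> nat \<Rightarrow> nat \<Rightarrow> int \<Rightarrow> 'a::field \<Rightarrow> 'a" where
  "qsumT b c l n r x =
     qfact (x ^ c) l * poly (map_poly of_int (cyclotomic c)) x ^ l
       / qfact (x ^ (c div b)) (n * b div c)
     * Sum_any (\<lambda>k::int.
         if k mod int c = r mod int c
         then (-1) powi k * x powi (k * (k - 1) div 2) * qbinom x (int n) k
                * qbinom (x ^ c) ((k - r) div int c) (int l)
         else 0)"

definition qvar :: "rat poly fract" where
  "qvar = to_fract [:0, 1:]"

definition laurent_polys :: "rat poly fract set" where
  "laurent_polys = {to_fract P / qvar ^ k | P k. True}"

definition cong_cyclotomic :: "nat \<Rightarrow> nat \<Rightarrow> rat poly fract \<Rightarrow> rat poly fract \<Rightarrow> bool" where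
  "cong_cyclotomic b m A B \<longleftrightarrow>
     (\<exists>U V. U \<in> laurent_polys \<and> V \<noteq> 0 \<and> \<not> map_poly of_int (cyclotomic b) dvd V \<and>
        A - B = to_fract (map_poly of_int (cyclotomic b)) ^ m * (U / to_fract V))"


subsection \<open>The definitions are proper\<close>

lemma qbinom_eq_0: "qbinom x (int n) k = 0" if "k < 0 \<or> k > int n"
proof (cases "k < 0")
  case False
  with that have "n \<in> {..<nat k}" by auto
  moreover have "qnum x (int n - int n) = 0" by (simp add: qnum_def)
  ultimately have "(\<Prod>i<nat k. qnum x (int n - int i)) = 0"
    by (intro prod_zero bexI[of _ n]) auto
  then show ?thesis by (simp add: qbinom_def)
qed (simp add: qbinom_def)

lemma qsumT_finite_sum:
  "qsumT b c l n r x =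
     qfact (x ^ c) l * poly (map_poly of_int (cyclotomic c)) x ^ l
       / qfact (x ^ (c div b)) (n * b div c)
     * (\<Sum>k | k \<in> {0..int n} \<and> k mod int c = r mod int c.
         (-1) powi k * x powi (k * (k - 1) div 2) * qbinom x (int n) k
           * qbinom (x ^ c) ((k - r) div int c) (int l))"
proof -
  let ?f = "\<lambda>k. (-1) powi k * x powi (k * (k - 1) div 2) * qbinom x (int n) k
           * qbinom (x ^ c) ((k - r) div int c) (int l)"
  let ?g = "\<lambda>k. if k mod int c = r mod int c then ?f k else 0"
  have fin: "finite {0..int n}" by simp
  have sub: "{k. ?g k \<noteq> 0} \<subseteq> {0..int n}"
  proof
    fix k assume "k \<in> {k. ?g k \<noteq> 0}"
    then have "qbinom x (int n) k \<noteq> 0" by (auto split: if_splits)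
    then have "\<not> (k < 0 \<or> k > int n)" using qbinom_eq_0[of k n x] by blast
    then show "k \<in> {0..int n}" by simp
  qed
  have "Sum_any ?g = sum ?g {0..int n}"
    by (rule Sum_any.expand_superset[OF fin sub])
  also have "\<dots> = sum ?f ({0..int n} \<inter> {k. k mod int c = r mod int c})"
    by (subst sum.inter_restrict) auto
  also have "{0..int n} \<inter> {k. k mod int c = r mod int c}
      = {k. k \<in> {0..int n} \<and> k mod int c = r mod int c}" by blast
  finally show ?thesis unfolding qsumT_def by simp
qed

lemma map_of_int_add:
  "map_poly of_int (p + q) = map_poly of_int p + (map_poly of_int q :: 'a::comm_ring_1 poly)"
  by (rule poly_eqI) (simp add: coeff_map_poly)

lemma map_of_int_mult:
  "map_poly of_int (p * q) = map_poly of_int p * (map_poly of_int q :: 'a::comm_ring_1 poly)"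
  by (rule poly_eqI) (simp add: coeff_map_poly coeff_mult)

lemma map_of_int_inj:
  "map_poly of_int p = (map_poly of_int q :: 'a::{comm_ring_1,ring_char_0} poly) \<Longrightarrow> p = q"
  by (simp add: poly_eq_iff coeff_map_poly)

lemma degree_map_of_int:
  "degree (map_poly of_int p :: 'a::{comm_ring_1,ring_char_0} poly) = degree p"
  by (rule degree_map_poly) auto

lemma integral_quotient:
  fixes h :: "complex poly"
  assumes eq: "map_poly of_int F = map_poly of_int G * h" and monic: "lead_coeff G = 1"
  shows "\<exists>H. h = map_poly of_int H"
proof -
  have G0: "G \<noteq> 0" using monic by auto
  obtain Q R where QR: "pseudo_divmod F G = (Q, R)" by (cases "pseudo_divmod F G")
  from pseudo_divmod[OF G0 QR] monic
  have F: "F = G * Q + R" and R: "R = 0 \<or> degree R < degree G" by auto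
  let ?c = "map_poly of_int :: int poly \<Rightarrow> complex poly"
  have *: "?c G * (h - ?c Q) = ?c R"
    using eq by (simp add: F map_of_int_add map_of_int_mult algebra_simps)
  have "h - ?c Q = 0"
  proof (rule ccontr)
    assume nz: "h - ?c Q \<noteq> 0"
    have G0': "?c G \<noteq> 0" using G0 map_of_int_inj[of G 0] by auto
    have "?c R \<noteq> 0" using * nz G0' by (metis mult_eq_0_iff)
    then have "degree R < degree G" using R by auto
    moreover have "degree (?c R) = degree (?c G) + degree (h - ?c Q)"
      using * degree_mult_eq[OF G0' nz] by simp
    ultimately show False by (simp add: degree_map_of_int)
  qed
  then show ?thesis by auto
qed

lemma finite_primitive_roots: "d > 0 \<Longrightarrow> finite (primitive_roots d)"
  by (rule finite_subset[OF _ finite_roots_unity[of d]]) (auto simp: primitive_roots_def)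

lemma primitive_roots_disjoint:
  "d > 0 \<Longrightarrow> e > 0 \<Longrightarrow> d \<noteq> e \<Longrightarrow> primitive_roots d \<inter> primitive_roots e = {}"
  by (cases d e rule: linorder_cases) (auto simp: primitive_roots_def)

lemma Union_primitive_roots:
  assumes "n > 0"
  shows "(\<Union>d\<in>{d. d dvd n}. primitive_roots d) = {z. z ^ n = 1}"
proof (intro equalityI subsetI)
  fix z assume "z \<in> (\<Union>d\<in>{d. d dvd n}. primitive_roots d)"
  then show "z \<in> {z. z ^ n = 1}" by (auto simp: primitive_roots_def power_mult elim!: dvdE)
next
  fix z :: complex assume "z \<in> {z. z ^ n = 1}"
  then have zn: "z ^ n = 1" by simp
  define d where "d = (LEAST d. d > 0 \<and> z ^ d = 1)"
  have d: "d > 0 \<and> z ^ d = 1" unfolding d_def by (rule LeastI[of _ n]) (use assms zn in auto)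
  have least: "z ^ m \<noteq> 1" if "0 < m" "m < d" for m
    using not_less_Least[of m "\<lambda>d. d > 0 \<and> z ^ d = 1"] that unfolding d_def by auto
  have "z ^ n = (z ^ d) ^ (n div d) * z ^ (n mod d)"
    by (simp flip: power_mult power_add)
  then have "z ^ (n mod d) = 1" using zn d by simp
  then have "n mod d = 0" using least[of "n mod d"] d by auto
  then have "d dvd n" by auto
  then show "z \<in> (\<Union>d\<in>{d. d dvd n}. primitive_roots d)"
    using d least by (auto simp: primitive_roots_def)
qed

lemma prod_roots_unity:
  assumes "n > 0"
  shows "(\<Prod>z | z ^ n = 1. [:- z, 1:]) = (monom 1 n - 1 :: complex poly)"
proof -
  let ?p = "monom 1 n - 1 :: complex poly"
  have p: "poly ?p z = z ^ n - 1" for z by (simp add: poly_monom)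
  have lc: "coeff ?p n = 1" using assms by simp
  have "degree ?p \<le> n" by (rule degree_diff_le) (auto simp: degree_monom_le)
  moreover have "degree ?p \<ge> n" using lc by (intro le_degree) simp
  ultimately have lead: "lead_coeff ?p = 1" using lc by simp
  have "rsquarefree ?p"
    unfolding rsquarefree_roots
    using assms by (auto simp: p pderiv_diff pderiv_monom poly_monom power_0_left)
  from complex_poly_decompose_rsquarefree[OF this] show ?thesis
    unfolding lead p by simp
qed

lemma of_int_cyclotomic:
  assumes "d > 0"
  shows "map_poly of_int (cyclotomic d) = (\<Prod>z\<in>primitive_roots d. [:- z, 1:])"
proof -
  let ?c = "map_poly of_int :: int poly \<Rightarrow> complex poly"
  let ?P = "\<lambda>d. \<Prod>z\<in>primitive_roots d. [:- z, 1:]"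
  have "\<exists>p. ?c p = ?P d" using assms
  proof (induction d rule: less_induct)
    case (less d)
    let ?D = "{e. e dvd d \<and> e \<noteq> d}"
    have fin: "finite ?D" using less.prems by simp
    have "\<exists>p. ?c p = ?P e" if "e \<in> ?D" for e
    proof (rule less.IH)
      from that less.prems have "e dvd d" "e \<noteq> d" "e \<le> d" by (auto intro: dvd_imp_le)
      then show "e < d" by simp
      from \<open>e dvd d\<close> less.prems show "e > 0" by (rule dvd_pos_nat[rotated])
    qed
    then have "\<forall>e\<in>?D. \<exists>p. ?c p = ?P e" by blast
    from bchoice[OF this] obtain f where f: "\<And>e. e \<in> ?D \<Longrightarrow> ?c (f e) = ?P e" by blast
    have "?c (prod f A) = (\<Prod>e\<in>A. ?c (f e))" for A
      by (induction A rule: infinite_finite_induct) (auto simp: map_of_int_mult)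
    then have G: "?c (prod f ?D) = (\<Prod>e\<in>?D. ?P e)" using f by simp
    have "lead_coeff (\<Prod>e\<in>?D. ?P e) = 1"
      by (simp add: lead_coeff_prod)
    then have "of_int (lead_coeff (prod f ?D)) = (1 :: complex)"
      unfolding G[symmetric] degree_map_of_int by (simp add: coeff_map_poly)
    then have monic: "lead_coeff (prod f ?D) = 1" by simp
    have "?c (monom 1 d - 1) = monom 1 d - 1"
      by (rule poly_eqI) (simp add: coeff_map_poly)
    also have "\<dots> = (\<Prod>z\<in>(\<Union>e\<in>{e. e dvd d}. primitive_roots e). [:- z, 1:])"
      using less.prems by (simp add: Union_primitive_roots prod_roots_unity)
    also have "\<dots> = (\<Prod>e\<in>{e. e dvd d}. ?P e)"
    proof (rule prod.UNION_disjoint)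
      have pos: "e > 0" if "e dvd d" for e using that less.prems by (rule dvd_pos_nat[rotated])
      show "finite {e. e dvd d}" using less.prems by simp
      show "\<forall>e\<in>{e. e dvd d}. finite (primitive_roots e)"
        using pos finite_primitive_roots by blast
      show "\<forall>e\<in>{e. e dvd d}. \<forall>e'\<in>{e. e dvd d}. e \<noteq> e' \<longrightarrow>
          primitive_roots e \<inter> primitive_roots e' = {}"
        using pos primitive_roots_disjoint by (intro ballI impI) simp
    qed
    also have "{e. e dvd d} = insert d ?D" by auto
    also have "(\<Prod>e\<in>insert d ?D. ?P e) = ?P d * (\<Prod>e\<in>?D. ?P e)"
      using fin by (subst prod.insert) auto
    finally have "?c (monom 1 d - 1) = ?c (prod f ?D) * ?P d" using G by (simp add: mult.commute)
    from integral_quotient[OF this monic] obtain H where "?P d = ?c H" ..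
    then show ?case by (intro exI[of _ H]) (rule sym)
  qed
  then obtain p where p: "?c p = ?P d" ..
  have "\<exists>!p. ?c p = ?P d"
    by (rule ex1I[of _ p]) (simp_all add: p map_of_int_inj[where 'a = complex])
  from theI'[OF this] show ?thesis unfolding cyclotomic_def .
qed

end

theory Submission
  imports Defs "HOL-Computational_Algebra.Field_as_Ring"
begin

text \<open>
  Working modulo \<open>\<Phi>\<^sub>b\<close> means specialising \<open>q\<close> to every primitive \<open>b\<close>-th root of unity \<open>z\<close>.
  As \<open>b\<close> divides \<open>c\<close>, \<open>\<Phi>\<^bsub>bc\<^esub>(X) = \<Phi>\<^sub>c(X\<^sup>b)\<close>, so the prefactors of the two sides agree as rational
  functions, and they are finite at \<open>z\<close> since \<open>[i]\<close> in base \<open>q\<^sup>c\<close> specialises to \<open>i\<close>.  The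
  substitution \<open>k = b j + t\<close> matches the summands one by one, by the \<open>q\<close>-Lucas congruence for the
  \<open>q\<close>-binomial coefficient and by \<open>(-1)\<^sup>b z\<^bsup>b(b-1)/2\<^esup> = -1\<close> for the sign and the power of \<open>q\<close>.
\<close>

section \<open>Gaussian binomial coefficients\<close>

text \<open>The quotient defining \<open>qbinom\<close> can degenerate to 0/0 at a root of unity.
  Pascal's recurrence involves no division, so it can be evaluated there.\<close>

fun gauss :: "'a::comm_ring_1 \<Rightarrow> nat \<Rightarrow> nat \<Rightarrow> 'a" where
  "gauss x n 0 = 1"
| "gauss x 0 (Suc k) = 0"
| "gauss x (Suc n) (Suc k) = gauss x n k + x ^ Suc k * gauss x n (Suc k)"

lemma gauss_eq_0: "n < k \<Longrightarrow> gauss x n k = 0"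
  by (induction x n k rule: gauss.induct) auto

lemma gauss_self [simp]: "gauss x n n = 1"
  by (induction n) (auto simp: gauss_eq_0)

lemma gauss_1: "gauss 1 n k = of_nat (n choose k)"
  by (induction "1::'a" n k rule: gauss.induct) auto

text \<open>The bridge from the recurrence to the product formula, removing one factor of numerator
  and denominator at a time. At a root of unity it also forces coefficients to vanish.\<close>

lemma gauss_absorption:
  "(1 - x ^ Suc k) * gauss x (Suc n) (Suc k) = (1 - x ^ Suc n) * gauss x n k"
proof (induction n arbitrary: k)
  case 0
  then show ?case by (cases k) auto
next
  case (Suc n)
  show ?case
  proof (cases k)
    case 0
    have "(1 - x) * gauss x (Suc (Suc n)) (Suc 0)
        = (1 - x) + x * ((1 - x) * gauss x (Suc n) (Suc 0))"
      unfolding gauss.simps(3)[of x "Suc n"] by (simp add: algebra_simps del: gauss.simps(3))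
    also have "(1 - x) * gauss x (Suc n) (Suc 0) = 1 - x ^ Suc n"
      using Suc.IH[of 0] by simp
    finally show ?thesis by (simp add: 0 algebra_simps del: gauss.simps(3))
  next
    case k: (Suc m)
    define A B C where "A = gauss x (Suc n) (Suc m)" and "B = gauss x n m"
      and "C = gauss x n (Suc m)"
    have A: "A = B + x ^ k * C" unfolding A_def B_def C_def k by simp
    have IH: "(1 - x ^ k) * A = (1 - x ^ Suc n) * B"
      using Suc.IH[of m] unfolding A_def B_def k .
    have IH': "(1 - x ^ Suc k) * gauss x (Suc n) (Suc k) = (1 - x ^ Suc n) * C"
      using Suc.IH[of k] unfolding C_def k .
    have "(1 - x ^ Suc k) * gauss x (Suc (Suc n)) (Suc k)
        = (1 - x ^ Suc k) * A + x ^ Suc k * ((1 - x ^ Suc k) * gauss x (Suc n) (Suc k))"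
      unfolding gauss.simps(3)[of x "Suc n" k] by (simp add: A_def k algebra_simps)
    \<comment> \<open>Since \<open>x ^ k * C = A - B\<close>, only \<open>A\<close> and
      \<open>B\<close> are left, and the induction hypothesis at \<open>m\<close> then eliminates
      \<open>B\<close>.\<close>
    also have "\<dots> = (1 - x ^ Suc k) * A + x * ((1 - x ^ Suc n) * (A - B))"
      unfolding IH' A by (simp add: algebra_simps)
    also have "\<dots> = (1 - x ^ Suc k) * A + x * ((1 - x ^ Suc n) * A - (1 - x ^ k) * A)"
      unfolding IH by (simp add: algebra_simps)
    also have "\<dots> = (1 - x ^ Suc (Suc n)) * A" by (simp add: algebra_simps)
    finally show ?thesis unfolding A_def k .
  qed
qed

lemma qnum_of_nat: "qnum x (int n) = (1 - x ^ n) / (1 - x)"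
  by (simp add: qnum_def)

lemma qbinom_eq_gauss:
  fixes x :: "'a::field"
  assumes "\<forall>i>0. x ^ i \<noteq> 1"
  shows "qbinom x (int n) (int k) = gauss x n k"
proof (induction k arbitrary: n)
  case 0
  then show ?case by (simp add: qbinom_def)
next
  case (Suc k)
  have ne: "1 - x ^ Suc k \<noteq> 0" "1 - x \<noteq> 0"
    using assms by (auto dest: spec[of _ 1] spec[of _ "Suc k"])
  show ?case
  proof (cases n)
    case 0
    then show ?thesis using qbinom_eq_0[of "int (Suc k)" 0 x] by simp
  next
    case n: (Suc m)
    have "(\<Prod>i<Suc k. qnum x (int n - int i)) = qnum x (int n) * (\<Prod>i<k. qnum x (int m - int i))"
      unfolding prod.lessThan_Suc_shift by (simp add: n)
    then have "qbinom x (int n) (int (Suc k))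
        = qnum x (int n) / qnum x (int (Suc k)) * qbinom x (int m) (int k)"
      unfolding qbinom_def nat_int by (simp add: mult.commute)
    also have "\<dots> = (1 - x ^ Suc m) * gauss x m k / (1 - x ^ Suc k)"
      unfolding Suc qnum_of_nat n using ne(2) by simp
    also have "\<dots> = gauss x n (Suc k)"
      unfolding gauss_absorption[symmetric] n using ne(1) by simp
    finally show ?thesis .
  qed
qed

section \<open>Primitive roots of unity and the \<open>q\<close>-Lucas congruence\<close>

lemma primitive_roots_power_eq_1_iff:
  assumes "z \<in> primitive_roots d" and "d > 0"
  shows "z ^ k = 1 \<longleftrightarrow> d dvd k"
proof
  assume "z ^ k = 1"
  moreover have "z ^ k = (z ^ d) ^ (k div d) * z ^ (k mod d)"
    by (simp flip: power_mult power_add)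
  ultimately have "z ^ (k mod d) = 1"
    using assms by (simp add: primitive_roots_def)
  moreover have "k mod d < d" using assms by simp
  ultimately have "\<not> 0 < k mod d" using assms(1) by (auto simp: primitive_roots_def)
  then show "d dvd k" by auto
next
  assume "d dvd k"
  then obtain m where "k = d * m" ..
  then show "z ^ k = 1" using assms by (simp add: primitive_roots_def power_mult)
qed

text \<open>The case \<open>n = b\<close> of the \<open>q\<close>-Lucas congruence, whose proof needs it to pass from one block
  of \<open>b\<close> rows to the next.\<close>

lemma gauss_root_eq_0:
  assumes z: "z \<in> primitive_roots b" and "0 < k" "k < b"
  shows "gauss z b k = 0"
proof -
  obtain m n where k: "k = Suc m" and b: "b = Suc n"
    using assms by (metis gr0_conv_Suc less_trans)
  have "z ^ k \<noteq> 1" "z ^ b = 1" using assms by (auto simp: primitive_roots_def)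
  then show ?thesis using gauss_absorption[of z m n] unfolding k b by simp
qed

text \<open>Induction on the row number by Pascal's recurrence. Since \<open>z ^ b = 1\<close>, its
  weight is \<open>z ^ t\<close>, whatever the block \<open>j\<close>; the four cases record whether
  the previous row or column lies in an earlier block.\<close>

lemma q_lucas:
  assumes z: "z \<in> primitive_roots b" and b: "b > 0"
  shows "s < b \<Longrightarrow> t < b \<Longrightarrow>
    gauss z (b * n + s) (b * j + t) = of_nat (n choose j) * gauss z s t"
proof (induction "b * n + s" arbitrary: n s j t)
  case 0
  then have "n = 0" "s = 0" using b by auto
  then show ?case using b
    by (cases "b * j + t"; cases j; cases t) auto
next
  case (Suc N)
  note IH = Suc.hyps(1) and N = Suc.hyps(2) and s = Suc.prems(1) and t = Suc.prems(2)
  have zb: "z ^ (b * i) = 1" for i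
    using z by (simp add: primitive_roots_def power_mult)
  show ?case
  proof (cases "b * j + t")
    case 0
    then show ?thesis using b by auto
  next
    case K: (Suc K)
    have step: "gauss z (b * n + s) (b * j + t) = gauss z N K + z ^ t * gauss z N (b * j + t)"
    proof -
      have "z ^ (b * j + t) = z ^ t" by (simp add: power_add zb)
      then show ?thesis unfolding N[symmetric] K by simp
    qed
    show ?thesis
    proof (cases s)
      case s': (Suc u)
      have Nu: "N = b * n + u" using N s' by simp
      have u: "u < b" using s s' by simp
      have b1: "gauss z N (b * j + t) = of_nat (n choose j) * gauss z u t"
        unfolding Nu by (rule IH[OF Nu u t])
      show ?thesis
      proof (cases t)
        case t': (Suc v)
        have Kv: "K = b * j + v" using K t' by simp
        have "gauss z N K = of_nat (n choose j) * gauss z u v"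
          unfolding Nu Kv by (rule IH[OF Nu u]) (use t t' in simp)
        then show ?thesis unfolding step b1 unfolding s' t' by (simp add: algebra_simps)
      next
        case t': 0
        then obtain i where j: "j = Suc i" using K by (cases j) auto
        \<comment> \<open>The column falls back to the last one of the previous block, which a row
          \<open>u < b - 1\<close> does not reach.\<close>
        have Kv: "K = b * i + (b - 1)" using K t' j b by simp
        have "gauss z N K = of_nat (n choose i) * gauss z u (b - 1)"
          unfolding Nu Kv by (rule IH[OF Nu u]) (use b in simp)
        also have "gauss z u (b - 1) = 0" by (rule gauss_eq_0) (use s s' in simp)
        finally show ?thesis unfolding step b1 unfolding t' by simp
      qed
    next
      case s': 0
      then obtain m where n: "n = Suc m" using N by (cases n) auto
      have Nu: "N = b * m + (b - 1)" using N s' n b by simp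
      have u: "b - 1 < b" using b by simp
      have b1: "gauss z N (b * j + t) = of_nat (m choose j) * gauss z (b - 1) t"
        unfolding Nu by (rule IH[OF Nu u t])
      show ?thesis
      proof (cases t)
        case t': (Suc v)
        have Kv: "K = b * j + v" using K t' by simp
        have "gauss z N K = of_nat (m choose j) * gauss z (b - 1) v"
          unfolding Nu Kv by (rule IH[OF Nu u]) (use t t' in simp)
        \<comment> \<open>Both terms carry \<open>m choose j\<close>, so their other factors
          recombine by Pascal's rule into an inner entry of row \<open>b\<close>, which is
          zero.\<close>
        then have "gauss z (b * n + s) (b * j + t)
            = of_nat (m choose j) * gauss z (Suc (b - 1)) (Suc v)"
          unfolding step b1 unfolding t' by (simp add: algebra_simps)
        also have "gauss z (Suc (b - 1)) (Suc v) = 0"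
          using gauss_root_eq_0[OF z, of t] t t' b by simp
        finally show ?thesis by (simp add: s' t')
      next
        case t': 0
        then obtain i where j: "j = Suc i" using K by (cases j) auto
        have Kv: "K = b * i + (b - 1)" using K t' j b by simp
        have "gauss z N K = of_nat (m choose i) * gauss z (b - 1) (b - 1)"
          unfolding Nu Kv by (rule IH[OF Nu u]) (use b in simp)
        \<comment> \<open>Both remaining Gaussian coefficients are 1, which leaves the ordinary
          Pascal rule for \<open>Suc m choose Suc i\<close>.\<close>
        then show ?thesis unfolding step b1 unfolding t' s' n j by simp
      qed
    qed
  qed
qed

section \<open>Cyclotomic polynomials\<close>

text \<open>Because of this, a polynomial that is nonzero at all primitive roots cannot be divisible
  by the cyclotomic polynomial.\<close>

lemma primitive_roots_nonempty:
  assumes "d > 0"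
  shows "primitive_roots d \<noteq> {}"
proof -
  let ?f = "\<lambda>k. cis (2 * pi * real k / real d)"
  have bij: "bij_betw ?f {..<d} {z. z ^ d = 1}" by (rule bij_betw_roots_unity[OF assms])
  have pow: "cis (2 * pi / real d) ^ m = ?f m" for m
    by (simp add: DeMoivre mult_ac)
  have "cis (2 * pi / real d) ^ m \<noteq> 1" if "0 < m" "m < d" for m
  proof
    assume "cis (2 * pi / real d) ^ m = 1"
    then have "?f m = ?f 0" by (simp add: pow)
    then have "m = 0" using bij that by (auto simp: bij_betw_def inj_on_def)
    with that show False by simp
  qed
  moreover have "cis (2 * pi / real d) ^ d = 1" using assms by (simp add: DeMoivre)
  ultimately have "cis (2 * pi / real d) \<in> primitive_roots d"
    by (simp add: primitive_roots_def)
  then show ?thesis by auto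
qed

text \<open>Taking \<open>b\<close>-th powers divides the order by \<open>b\<close> only if
  \<open>b\<close> divides that order, which \<open>b dvd c\<close> ensures. For
  \<open>b = 2\<close> and \<open>c = 1\<close> the number \<open>w = 1\<close> would be a
  counterexample.\<close>

lemma primitive_roots_mult_iff:
  assumes "b dvd c" and "c > 0" and "b > 0"
  shows "w \<in> primitive_roots (b * c) \<longleftrightarrow> w ^ b \<in> primitive_roots c"
proof
  assume w: "w \<in> primitive_roots (b * c)"
  show "w ^ b \<in> primitive_roots c"
    unfolding primitive_roots_def
    using primitive_roots_power_eq_1_iff[OF w] assms
    by (auto simp flip: power_mult dest: nat_dvd_not_less)
next
  assume wb: "w ^ b \<in> primitive_roots c"
  have "w ^ m \<noteq> 1" if "0 < m" "m < b * c" for m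
  proof
    assume m: "w ^ m = 1"
    have iff: "(w ^ b) ^ i = 1 \<longleftrightarrow> c dvd i" for i
      by (rule primitive_roots_power_eq_1_iff[OF wb \<open>c > 0\<close>])
    have "(w ^ b) ^ m = (w ^ m) ^ b" by (simp add: mult.commute flip: power_mult)
    \<comment> \<open>This first pass makes \<open>b\<close> divide \<open>m\<close>; the same
      criterion applied to \<open>m div b\<close> then yields the missing factor.\<close>
    then have "c dvd m" using iff m by simp
    then obtain i where i: "m = b * i" using \<open>b dvd c\<close> by (meson dvdE dvd_trans)
    then have "c dvd i" using iff[of i] m by (simp add: power_mult)
    then have "b * c dvd m" using i by simp
    with that show False by (auto dest: nat_dvd_not_less)
  qed
  moreover have "w ^ (b * c) = 1" using wb by (simp add: primitive_roots_def power_mult)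
  ultimately show "w \<in> primitive_roots (b * c)" by (simp add: primitive_roots_def)
qed

lemma prod_nth_roots:
  fixes z :: complex
  assumes "n > 0" and "z \<noteq> 0"
  shows "(\<Prod>w | w ^ n = z. [:- w, 1:]) = monom 1 n - [:z:]"
proof -
  let ?p = "monom 1 n - [:z:]"
  have p: "poly ?p w = w ^ n - z" for w by (simp add: poly_monom)
  have lc: "coeff ?p n = 1" using assms by (simp add: coeff_eq_0)
  have "degree ?p \<le> n" by (rule degree_diff_le) (auto simp: degree_monom_le)
  moreover have "degree ?p \<ge> n" using lc by (intro le_degree) simp
  ultimately have lead: "lead_coeff ?p = 1" using lc by simp
  \<comment> \<open>The derivative can vanish only at 0, which is no root because
    \<open>z \<noteq> 0\<close>.\<close>
  have "rsquarefree ?p"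
    unfolding rsquarefree_roots
    using assms by (auto simp: p pderiv_diff pderiv_monom poly_monom power_0_left pderiv_pCons)
  from complex_poly_decompose_rsquarefree[OF this] show ?thesis
    unfolding lead p by simp
qed

lemma pcompose_prod: "pcompose (prod f A) p = (\<Prod>a\<in>A. pcompose (f a) p)"
  by (induction A rule: infinite_finite_induct) (auto simp: pcompose_mult pcompose_1)

lemma map_of_int_pcompose:
  "map_poly of_int (pcompose p q) =
     pcompose (map_poly of_int p) (map_poly of_int q :: 'a::comm_ring_1 poly)"
proof (induction p)
  case (pCons a p)
  then show ?case
    by (simp add: pcompose_pCons map_of_int_add map_of_int_mult map_poly_pCons)
qed simp

text \<open>The roots on the left split into the fibres of \<open>w ^ b = z\<close> over the
  primitive \<open>c\<close>-th roots \<open>z\<close>, and each fibre contributes the factor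
  \<open>X ^ b - z\<close>. The comparison is made over the complex numbers, where everything
  splits.\<close>

lemma cyclotomic_mult:
  assumes "b dvd c" and "c > 0" and "b > 0"
  shows "cyclotomic (b * c) = pcompose (cyclotomic c) (monom 1 b)"
proof (rule map_of_int_inj[where 'a = complex])
  have fin: "finite {w :: complex. w ^ b = z}" for z
    by (rule finite_nth_roots) fact
  have ne: "z \<noteq> 0" if "z \<in> primitive_roots c" for z
    using that \<open>c > 0\<close> by (auto simp: primitive_roots_def power_0_left)
  have "map_poly of_int (cyclotomic (b * c)) = (\<Prod>w\<in>primitive_roots (b * c). [:- w, 1:])"
    using assms by (intro of_int_cyclotomic) simp
  also have "primitive_roots (b * c) = (\<Union>z\<in>primitive_roots c. {w. w ^ b = z})"
    using primitive_roots_mult_iff[OF assms] by auto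
  also have "(\<Prod>w\<in>\<dots>. [:- w, 1:]) = (\<Prod>z\<in>primitive_roots c. \<Prod>w | w ^ b = z. [:- w, 1:])"
    using finite_primitive_roots[OF \<open>c > 0\<close>] fin by (intro prod.UNION_disjoint) auto
  also have "\<dots> = (\<Prod>z\<in>primitive_roots c. pcompose [:- z, 1:] (monom 1 b))"
    using ne \<open>b > 0\<close> by (intro prod.cong) (auto simp: prod_nth_roots pcompose_pCons)
  also have "\<dots> = pcompose (map_poly of_int (cyclotomic c)) (monom 1 b)"
    using \<open>c > 0\<close> by (simp add: of_int_cyclotomic pcompose_prod)
  also have "\<dots> = map_poly of_int (pcompose (cyclotomic c) (monom 1 b))"
    by (simp add: map_of_int_pcompose map_poly_monom)
  finally show "map_poly of_int (cyclotomic (b * c))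
      = (map_poly of_int (pcompose (cyclotomic c) (monom 1 b)) :: complex poly)" .
qed

lemma poly_cyclotomic_mult:
  fixes x :: "'a::field"
  assumes "b dvd c" and "c > 0" and "b > 0"
  shows "poly (map_poly of_int (cyclotomic (b * c))) x
    = poly (map_poly of_int (cyclotomic c)) (x ^ b)"
  by (simp add: cyclotomic_mult[OF assms] map_of_int_pcompose map_poly_monom poly_pcompose
      poly_monom)

section \<open>Specialisation of rational functions\<close>

definition rat_eval :: "rat poly \<Rightarrow> complex \<Rightarrow> complex" where
  "rat_eval p z = poly (map_poly of_rat p) z"

lemma rat_eval_simps [simp]:
  "rat_eval 0 z = 0" "rat_eval 1 z = 1" "rat_eval (pCons a p) z = of_rat a + z * rat_eval p z"
  by (simp_all add: rat_eval_def map_poly_pCons)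

lemma rat_eval_add [simp]: "rat_eval (p + q) z = rat_eval p z + rat_eval q z"
proof -
  have "map_poly of_rat (p + q) = map_poly of_rat p + (map_poly of_rat q :: complex poly)"
    by (rule poly_eqI) (simp add: coeff_map_poly of_rat_add)
  then show ?thesis by (simp add: rat_eval_def)
qed

lemma rat_eval_mult [simp]: "rat_eval (p * q) z = rat_eval p z * rat_eval q z"
proof -
  have "map_poly of_rat (p * q) = map_poly of_rat p * (map_poly of_rat q :: complex poly)"
    by (rule poly_eqI) (simp add: coeff_map_poly coeff_mult of_rat_sum of_rat_mult)
  then show ?thesis by (simp add: rat_eval_def)
qed

lemma rat_eval_uminus [simp]: "rat_eval (- p) z = - rat_eval p z"
  using rat_eval_add[of p "- p" z] by (simp add: add_eq_0_iff del: rat_eval_add)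

lemma map_of_rat_of_int:
  "map_poly of_rat (map_poly of_int p) = (map_poly of_int p :: complex poly)"
  by (rule poly_eqI) (simp add: coeff_map_poly)

lemma rat_eval_of_int: "rat_eval (map_poly of_int p) z = poly (map_poly of_int p) z"
  by (simp add: rat_eval_def map_of_rat_of_int)

lemma rat_eval_cyclotomic:
  assumes "d > 0"
  shows "rat_eval (map_poly of_int (cyclotomic d)) z = 0 \<longleftrightarrow> z \<in> primitive_roots d"
  using assms finite_primitive_roots[OF assms]
  by (auto simp: rat_eval_of_int of_int_cyclotomic poly_prod)

text \<open>For the converse, the remainder has degree below \<open>card (primitive_roots d)\<close>
  and yet vanishes at all these distinct points, so it is zero.\<close>

lemma cyclotomic_dvd_iff:
  assumes "d > 0"
  shows "map_poly of_int (cyclotomic d) dvd p \<longleftrightarrow> (\<forall>z\<in>primitive_roots d. rat_eval p z = 0)"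
    (is "?\<Phi> dvd p \<longleftrightarrow> ?rhs")
proof
  assume "?\<Phi> dvd p"
  then show ?rhs using rat_eval_cyclotomic[OF assms] by (auto elim!: dvdE)
next
  assume p: ?rhs
  define r where "r = p mod ?\<Phi>"
  have deg: "degree ?\<Phi> = card (primitive_roots d)"
  proof -
    have "degree ?\<Phi> = degree (map_poly of_int (cyclotomic d) :: complex poly)"
      by (simp add: degree_map_of_int)
    also have "\<dots> = card (primitive_roots d)"
      using finite_primitive_roots[OF assms] assms
      by (simp add: of_int_cyclotomic degree_prod_sum_eq)
    finally show ?thesis .
  qed
  then have ne: "?\<Phi> \<noteq> 0"
    using primitive_roots_nonempty[OF assms] finite_primitive_roots[OF assms]
    by (metis card_eq_0_iff degree_0)
  have r: "rat_eval r z = 0" if "z \<in> primitive_roots d" for z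
  proof -
    have "rat_eval p z = rat_eval (?\<Phi> * (p div ?\<Phi>) + r) z" unfolding r_def by simp
    also have "\<dots> = rat_eval r z"
      using that rat_eval_cyclotomic[OF assms] by simp
    finally show ?thesis using p that by simp
  qed
  have "r = 0"
  proof (rule ccontr)
    assume r0: "r \<noteq> 0"
    let ?r = "map_poly of_rat r :: complex poly"
    have r0': "?r \<noteq> 0" using r0 by (simp add: map_poly_eq_0_iff)
    have "card (primitive_roots d) \<le> card {z. poly ?r z = 0}"
      using r r0' by (intro card_mono poly_roots_finite) (auto simp: rat_eval_def)
    also have "\<dots> \<le> degree ?r" using r0' by (rule card_poly_roots_bound)
    also have "\<dots> = degree r" by (rule degree_map_poly) auto
    also have "\<dots> < degree ?\<Phi>" using r0 ne degree_mod_less[of ?\<Phi> p] unfolding r_def by auto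
    finally show False using deg by simp
  qed
  then show "?\<Phi> dvd p" unfolding r_def by (simp add: mod_eq_0_iff_dvd)
qed

text \<open>A relation rather than a function, since a rational function may have a pole at
  \<open>z\<close>. Any fraction whose denominator survives at \<open>z\<close> serves as a
  witness.\<close>

definition specializes :: "complex \<Rightarrow> rat poly fract \<Rightarrow> complex \<Rightarrow> bool" where
  "specializes z f w \<longleftrightarrow> (\<exists>P V. rat_eval V z \<noteq> 0 \<and> f = to_fract P / to_fract V
     \<and> w = rat_eval P z / rat_eval V z)"

lemma specializesI:
  "rat_eval V z \<noteq> 0 \<Longrightarrow> f = to_fract P / to_fract V \<Longrightarrow> w = rat_eval P z / rat_eval V z
    \<Longrightarrow> specializes z f w"
  unfolding specializes_def by blast

lemma specializesE:
  assumes "specializes z f w"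
  obtains P V where "rat_eval V z \<noteq> 0" "V \<noteq> 0" "f = to_fract P / to_fract V"
    "w = rat_eval P z / rat_eval V z"
  using assms rat_eval_simps(1) unfolding specializes_def by metis

lemma specializes_to_fract: "specializes z (to_fract p) (rat_eval p z)"
  by (rule specializesI[of 1 _ _ p]) auto

lemma specializes_1: "specializes z 1 1"
  using specializes_to_fract[of z 1] by simp

lemma specializes_0: "specializes z 0 0"
  using specializes_to_fract[of z 0] by simp

lemma specializes_qvar: "specializes z qvar z"
  using specializes_to_fract[of z "[:0, 1:]"] by (simp add: qvar_def)

lemma specializes_add:
  assumes "specializes z f v" "specializes z g w"
  shows "specializes z (f + g) (v + w)"
proof -
  obtain P V where 1: "rat_eval V z \<noteq> 0" "V \<noteq> 0" "f = to_fract P / to_fract V"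
    "v = rat_eval P z / rat_eval V z" using assms(1) by (rule specializesE)
  obtain Q W where 2: "rat_eval W z \<noteq> 0" "W \<noteq> 0" "g = to_fract Q / to_fract W"
    "w = rat_eval Q z / rat_eval W z" using assms(2) by (rule specializesE)
  show ?thesis
    by (rule specializesI[of "V * W" _ _ "P * W + Q * V"]) (use 1 2 in \<open>auto simp: add_frac_eq\<close>)
qed

lemma specializes_mult:
  assumes "specializes z f v" "specializes z g w"
  shows "specializes z (f * g) (v * w)"
proof -
  obtain P V where 1: "rat_eval V z \<noteq> 0" "V \<noteq> 0" "f = to_fract P / to_fract V"
    "v = rat_eval P z / rat_eval V z" using assms(1) by (rule specializesE)
  obtain Q W where 2: "rat_eval W z \<noteq> 0" "W \<noteq> 0" "g = to_fract Q / to_fract W"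
    "w = rat_eval Q z / rat_eval W z" using assms(2) by (rule specializesE)
  show ?thesis
    by (rule specializesI[of "V * W" _ _ "P * Q"]) (use 1 2 in auto)
qed

lemma specializes_uminus:
  assumes "specializes z f v"
  shows "specializes z (- f) (- v)"
proof -
  obtain P V where 1: "rat_eval V z \<noteq> 0" "V \<noteq> 0" "f = to_fract P / to_fract V"
    "v = rat_eval P z / rat_eval V z" using assms(1) by (rule specializesE)
  show ?thesis
    by (rule specializesI[of "V" _ _ "- P"]) (use 1 in auto)
qed

lemma specializes_diff:
  "specializes z f v \<Longrightarrow> specializes z g w \<Longrightarrow> specializes z (f - g) (v - w)"
  using specializes_add[OF _ specializes_uminus] by fastforce

lemma specializes_inverse:
  assumes "specializes z f v" "v \<noteq> 0"
  shows "specializes z (inverse f) (inverse v)"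
proof -
  obtain P V where 1: "rat_eval V z \<noteq> 0" "V \<noteq> 0" "f = to_fract P / to_fract V"
    "v = rat_eval P z / rat_eval V z" using assms(1) by (rule specializesE)
  show ?thesis
    by (rule specializesI[of P _ _ V]) (use 1 assms(2) in auto)
qed

lemma specializes_divide:
  "specializes z f v \<Longrightarrow> specializes z g w \<Longrightarrow> w \<noteq> 0 \<Longrightarrow> specializes z (f / g) (v / w)"
  unfolding divide_inverse by (intro specializes_mult specializes_inverse)

lemma specializes_power: "specializes z f v \<Longrightarrow> specializes z (f ^ n) (v ^ n)"
  by (induction n) (auto intro: specializes_1 specializes_mult)

lemma specializes_sum:
  "(\<And>i. i \<in> A \<Longrightarrow> specializes z (f i) (g i)) \<Longrightarrow> specializes z (\<Sum>i\<in>A. f i) (\<Sum>i\<in>A. g i)"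
  by (induction A rule: infinite_finite_induct) (auto intro: specializes_0 specializes_add)

lemma specializes_prod:
  "(\<And>i. i \<in> A \<Longrightarrow> specializes z (f i) (g i)) \<Longrightarrow> specializes z (\<Prod>i\<in>A. f i) (\<Prod>i\<in>A. g i)"
  by (induction A rule: infinite_finite_induct) (auto intro: specializes_1 specializes_mult)

lemma specializes_gauss:
  assumes f: "specializes z f v"
  shows "specializes z (gauss f n k) (gauss v n k)"
proof (induction n arbitrary: k)
  case 0
  then show ?case by (cases k) (auto intro: specializes_0 specializes_1)
next
  case (Suc n)
  show ?case
    by (cases k)
      (auto simp del: power_Suc
        intro!: specializes_1 specializes_add specializes_mult specializes_power Suc.IH f)
qed

lemma specializes_of_int: "specializes z (of_int a) (of_int a)"
proof (induction a rule: int_induct[of _ 0])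
  case base
  show ?case by (simp add: specializes_0)
next
  case (step1 i)
  then show ?case by (simp add: specializes_add specializes_1)
next
  case (step2 i)
  then show ?case by (simp add: specializes_diff specializes_1)
qed

lemma specializes_poly_of_int:
  assumes "specializes z f v"
  shows "specializes z (poly (map_poly of_int p) f) (poly (map_poly of_int p) v)"
proof (induction p)
  case (pCons a p)
  then show ?case
    using assms specializes_of_int[of z a]
    by (simp add: map_poly_pCons specializes_add specializes_mult)
qed (auto intro: specializes_0)

text \<open>In lowest terms \<open>P / V\<close>, the difference \<open>f - g\<close> has value 0 at
  each primitive root, so \<open>P\<close> vanishes there. The Bezout identity then keeps
  \<open>V\<close> from vanishing, and \<open>cyclotomic_dvd_iff\<close> translates both facts into
  divisibility.\<close>

lemma cong_cyclotomicI:
  assumes "b > 0"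
    and eval: "\<And>z. z \<in> primitive_roots b \<Longrightarrow> \<exists>w. specializes z f w \<and> specializes z g w"
  shows "cong_cyclotomic b 1 f g"
proof -
  let ?\<Phi> = "map_poly of_int (cyclotomic b) :: rat poly"
  \<comment> \<open>The fractions witnessing \<open>specializes\<close> vary with \<open>z\<close>;
    the reduced one serves all roots at once.\<close>
  define P V where "P = fst (quot_of_fract (f - g))" and "V = snd (quot_of_fract (f - g))"
  have fg: "f - g = to_fract P / to_fract V"
    unfolding P_def V_def by (simp flip: Fract_conv_to_fract)
  have V0: "V \<noteq> 0" unfolding V_def by simp
  have "coprime P V" unfolding P_def V_def by (rule coprime_quot_of_fract)
  then obtain A B where bezout: "A * P + B * V = 1"
    by (metis bezout_coefficients_fst_snd coprime_iff_gcd_eq_1)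
  have root: "rat_eval P z = 0" "rat_eval V z \<noteq> 0" if "z \<in> primitive_roots b" for z
  proof -
    from eval[OF that] obtain w where "specializes z f w" "specializes z g w" by blast
    from specializes_diff[OF this] have "specializes z (f - g) 0" by simp
    then obtain Q W where QW: "rat_eval W z \<noteq> 0" "W \<noteq> 0" "f - g = to_fract Q / to_fract W"
      "0 = rat_eval Q z / rat_eval W z" by (rule specializesE)
    have "to_fract (P * W) = to_fract (Q * V)"
      using fg QW(2,3) V0 by (simp add: frac_eq_eq)
    then have "P * W = Q * V" by (simp only: to_fract_eq_iff)
    then have "rat_eval P z * rat_eval W z = rat_eval Q z * rat_eval V z"
      by (metis rat_eval_mult)
    with QW show P: "rat_eval P z = 0" by simp
    have "rat_eval (A * P + B * V) z = 1" unfolding bezout by simp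
    with P show "rat_eval V z \<noteq> 0" by auto
  qed
  have "?\<Phi> dvd P" using root(1) cyclotomic_dvd_iff[OF \<open>b > 0\<close>] by blast
  then obtain U where U: "P = ?\<Phi> * U" ..
  have "\<not> ?\<Phi> dvd V"
    using root(2) cyclotomic_dvd_iff[OF \<open>b > 0\<close>] primitive_roots_nonempty[OF \<open>b > 0\<close>] by blast
  moreover have "to_fract U \<in> laurent_polys"
    unfolding laurent_polys_def by (intro CollectI exI[of _ U] exI[of _ "0::nat"]) simp
  ultimately show ?thesis
    unfolding cong_cyclotomic_def using V0
    by (intro exI[of _ "to_fract U"] exI[of _ V] conjI) (simp_all add: fg U)
qed

section \<open>The congruence\<close>

lemma qvar_power: "qvar ^ n = to_fract (monom 1 n)"
proof (induction n)
  case (Suc n)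
  then show ?case by (simp add: qvar_def monom_Suc flip: to_fract_mult)
qed (simp flip: one_pCons add: monom_0)

lemma qvar_power_neq_1: "\<forall>n>0. qvar ^ n \<noteq> 1"
proof (intro allI impI notI)
  fix n :: nat assume "n > 0" "qvar ^ n = 1"
  then have "monom (1::rat) n = 1" using qvar_power[of n] by (metis to_fract_1 to_fract_eq_iff)
  then have "degree (monom (1::rat) n) = 0" by simp
  with \<open>n > 0\<close> show False by (simp add: degree_monom_eq)
qed

section \<open>Values of \<open>q\<close>-numbers whose base specialises to 1\<close>

lemma specializes_qnum:
  assumes f: "specializes z f 1" and "f \<noteq> 1"
  shows "specializes z (qnum f m) (of_int m)"
proof -
  \<comment> \<open>The quotient becomes 0/0 at \<open>z\<close>. As \<open>f\<close> itself differs
    from 1, it equals a geometric sum, which has a value there.\<close>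
  have geo: "qnum f (int n) = (\<Sum>i<n. f ^ i)" for n
    using \<open>f \<noteq> 1\<close> by (simp add: qnum_of_nat sum_gp_strict)
  have nat: "specializes z (qnum f (int n)) (of_nat n)" for n
    using specializes_sum[of "{..<n}" z "\<lambda>i. f ^ i" "\<lambda>i. 1 ^ i"] specializes_power[OF f]
    by (simp add: geo)
  show ?thesis
  proof (cases m)
    case (nonneg n)
    then show ?thesis using nat by simp
  next
    \<comment> \<open>Negative arguments occur because \<open>(k - r) / c\<close> can be negative.
      They reduce to positive ones by \<open>[-m] = - [m] / f ^ m\<close>.\<close>
    case (neg n)
    have "f \<noteq> 0"
    proof
      assume "f = 0"
      with specializes_diff[OF specializes_0 f] have "specializes z 0 (- 1)" by simp
      then show False by (auto elim!: specializesE)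
    qed
    then have "qnum f m = - (qnum f (int (Suc n)) / f ^ Suc n)"
      using \<open>f \<noteq> 1\<close> unfolding neg qnum_of_nat
      by (simp add: qnum_def power_int_minus field_simps del: of_nat_Suc)
    moreover have "specializes z \<dots> (- (of_nat (Suc n) / 1 ^ Suc n))"
      by (intro specializes_uminus specializes_divide nat specializes_power f) simp
    ultimately show ?thesis by (simp add: neg)
  qed
qed

lemma specializes_qfact:
  assumes "specializes z f 1" and "f \<noteq> 1"
  shows "specializes z (qfact f m) (fact m)"
proof -
  have "specializes z (\<Prod>i=1..m. qnum f (int i)) (\<Prod>i=1..m. of_int (int i))"
    by (intro specializes_prod specializes_qnum assms)
  then show ?thesis by (simp add: qfact_def fact_prod)
qed

text \<open>The value is the ordinary binomial coefficient, written with a falling factorial because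
  \<open>m\<close> may be negative.\<close>

lemma specializes_qbinom:
  assumes "specializes z f 1" and "f \<noteq> 1"
  shows "specializes z (qbinom f m (int l)) ((\<Prod>i<l. of_int (m - int i)) / fact l)"
  using specializes_qfact[OF assms, of l] specializes_qnum[OF assms]
  by (auto simp: qbinom_def qfact_def simp del: of_int_diff
      intro!: specializes_divide specializes_prod)

section \<open>Reindexing the sum and tracking its signs\<close>

lemma qsumT_eq:
  fixes x :: "'a::field"
  assumes "\<forall>i>0. x ^ i \<noteq> 1"
  shows "qsumT b c l n (int r) x =
     qfact (x ^ c) l * poly (map_poly of_int (cyclotomic c)) x ^ l
       / qfact (x ^ (c div b)) (n * b div c)
     * (\<Sum>k | k \<le> n \<and> k mod c = r mod c. (-1) ^ k * x ^ (k choose 2) * gauss x n k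
           * qbinom (x ^ c) ((int k - int r) div int c) (int l))"
proof -
  have ch: "int k * (int k - 1) div 2 = int (k choose 2)" for k
    by (cases k) (simp_all add: choose_two zdiv_int algebra_simps)
  have "(\<Sum>k | k \<in> {0..int n} \<and> k mod int c = int r mod int c.
          (-1) powi k * x powi (k * (k - 1) div 2) * qbinom x (int n) k
           * qbinom (x ^ c) ((k - int r) div int c) (int l))
      = (\<Sum>k | k \<le> n \<and> k mod c = r mod c. (-1) ^ k * x ^ (k choose 2) * gauss x n k
           * qbinom (x ^ c) ((int k - int r) div int c) (int l))"
    by (rule sum.reindex_bij_witness[of _ int nat])
      (auto simp: ch qbinom_eq_gauss[OF assms] simp flip: zmod_int
        dest!: zero_le_imp_eq_int)
  then show ?thesis by (simp add: qsumT_finite_sum)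
qed

text \<open>The congruence forces \<open>k mod b = t\<close>, hence \<open>k = b * j + t\<close>. If
  \<open>t > s\<close>, the index \<open>j = n\<close> overshoots the range on the left, and
  \<open>zero\<close> discards that term.\<close>

lemma sum_residue_class_shift:
  fixes b c n r s t :: nat and f :: "nat \<Rightarrow> 'a::comm_monoid_add"
  assumes "s < b" "t < b" and zero: "\<And>k. k > b * n + s \<Longrightarrow> f k = 0"
  shows "(\<Sum>k | k \<le> b * n + s \<and> k mod (b * c) = (b * r + t) mod (b * c). f k)
    = (\<Sum>j | j \<le> n \<and> j mod c = r mod c. f (b * j + t))"
proof -
  let ?A = "{k. k \<le> b * n + s \<and> k mod (b * c) = (b * r + t) mod (b * c)}"
  let ?J = "{j. j \<le> n \<and> j mod c = r mod c}"
  have mod: "(b * j + t) mod (b * c) = b * (j mod c) + t" for j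
    using \<open>t < b\<close> by (simp add: mod_mult2_eq)
  have sub: "?A \<subseteq> (\<lambda>j. b * j + t) ` ?J"
  proof
    fix k assume k: "k \<in> ?A"
    have "k mod b = (b * r + t) mod b"
      using k mod_mod_cancel[of b "b * c" k] mod_mod_cancel[of b "b * c" "b * r + t"] by simp
    then have kt: "k mod b = t" using \<open>t < b\<close> by simp
    then have eq: "k = b * (k div b) + t" using mult_div_mod_eq[of b k] by simp
    have "(k div b) mod c = r mod c"
      using k mod[of "k div b"] mod[of r] \<open>t < b\<close> by (simp flip: eq)
    moreover have "k div b \<le> (b * n + s) div b" using k by (intro div_le_mono) simp
    then have "k div b \<le> n" using \<open>s < b\<close> by simp
    ultimately show "k \<in> (\<lambda>j. b * j + t) ` ?J" using eq by blast
  qed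
  have "sum f ?A = sum f ((\<lambda>j. b * j + t) ` ?J)"
    using sub by (rule sum.mono_neutral_left[rotated]) (auto simp: mod intro!: zero)
  also have "\<dots> = (\<Sum>j\<in>?J. f (b * j + t))"
    using \<open>t < b\<close> by (subst sum.reindex) (auto simp: inj_on_def)
  finally show ?thesis .
qed

text \<open>For odd \<open>b\<close> the exponent is a multiple of \<open>b\<close>, so the sign
  comes from \<open>(-1) ^ b\<close>. For even \<open>b\<close> it is an odd multiple of
  \<open>b div 2\<close>, and \<open>z ^ (b div 2) = -1\<close> by primitivity.\<close>

lemma primitive_root_choose_two:
  assumes z: "z \<in> primitive_roots b" and "b > 0"
  shows "(-1) ^ b * z ^ (b choose 2) = -1"
proof (cases "even b")
  case True
  then obtain h where h: "b = 2 * h" by (rule evenE)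
  with \<open>b > 0\<close> have "h > 0" "h < b" by auto
  then have "z ^ h \<noteq> 1" "(z ^ h)\<^sup>2 = 1"
    using z by (auto simp: primitive_roots_def h mult.commute simp flip: power_mult)
  then have zh: "z ^ h = -1" by (auto simp: power2_eq_1_iff)
  have "b choose 2 = h * (b - 1)" by (simp add: choose_two h)
  moreover have "odd (b - 1)" using True \<open>b > 0\<close> by simp
  ultimately show ?thesis using True by (simp add: power_mult zh)
next
  case False
  then obtain h where h: "b = 2 * h + 1" by (rule oddE)
  then have "b choose 2 = b * h" by (simp add: choose_two)
  then show ?thesis using False z by (simp add: power_mult primitive_roots_def)
qed

lemma choose_two_add: "(m + n) choose 2 = (m choose 2) + (n choose 2) + m * n"
  by (induction n) (simp_all add: numeral_2_eq_2)

text \<open>Each shift by \<open>b\<close> contributes the factor -1 of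
  \<open>primitive_root_choose_two\<close>; the cross term in \<open>choose_two_add\<close> is a
  multiple of \<open>b\<close> and disappears.\<close>

lemma primitive_root_sign:
  assumes z: "z \<in> primitive_roots b" and "b > 0"
  shows "(-1) ^ (b * j + t) * z ^ ((b * j + t) choose 2) = (-1) ^ t * z ^ (t choose 2) * (-1) ^ j"
proof (induction j)
  case (Suc j)
  have zb: "z ^ (b * m) = 1" for m
    using z by (simp add: primitive_roots_def power_mult)
  have k: "b * Suc j + t = b + (b * j + t)" by simp
  have "(-1) ^ (b * Suc j + t) * z ^ ((b * Suc j + t) choose 2)
      = ((-1) ^ b * z ^ (b choose 2)) * ((-1) ^ (b * j + t) * z ^ ((b * j + t) choose 2))"
    unfolding k choose_two_add[of b] power_add[of "-1" b] by (simp only: power_add zb) simp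
  then show ?case unfolding Suc primitive_root_choose_two[OF assms] by simp
qed simp

theorem theorem3p1:
  fixes b c l n r s t :: nat
  assumes "b \<ge> 2" and "s \<le> b - 1" and "t \<le> b - 1"
    and "c > 0" and "b dvd c"
  shows "cong_cyclotomic b 1
           (qsumT b (b * c) l (b * n + s) (int (b * r + t)) qvar)
           ((-1) ^ t * qvar ^ (t choose 2) * qbinom qvar (int s) (int t)
              * qsumT b c l n (int r) (qvar ^ b))"
proof (rule cong_cyclotomicI)
  have b: "b > 0" "s < b" "t < b" using assms by auto
  then show "b > 0" by simp
  define Q where "Q = qvar ^ (b * c)"
  \<comment> \<open>The common prefactor: both \<open>q ^ (b * c div b)\<close> and
    \<open>(q ^ b) ^ (c div b)\<close> equal \<open>q ^ c\<close>.\<close>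
  define F where "F = qfact Q l * poly (map_poly of_int (cyclotomic c)) (qvar ^ b) ^ l
    / qfact (qvar ^ c) (n * b div c)"
  define H where "H j = qbinom Q ((int j - int r) div int c) (int l)" for j
  \<comment> \<open>With \<open>c = b * d\<close> both floors are \<open>n div d\<close>, because
    \<open>s < b\<close>.\<close>
  have fl: "(b * n + s) * b div (b * c) = n * b div c"
  proof -
    obtain d where d: "c = b * d" using \<open>b dvd c\<close> ..
    have "(b * n + s) * b div (b * c) = (b * n + s) div b div d"
      using b by (simp add: mult.commute[of _ b] d div_mult2_eq)
    also have "\<dots> = n * b div c" using b by (simp add: d mult.commute[of n])
    finally show ?thesis .
  qed
  have H: "qbinom (qvar ^ (b * c)) ((int (b * j + t) - int (b * r + t)) div int (b * c)) (int l)
      = H j" for j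
  proof -
    have "int (b * j + t) - int (b * r + t) = int b * (int j - int r)"
      by (simp add: algebra_simps)
    then show ?thesis using b by (simp add: H_def Q_def)
  qed
  have lhs: "qsumT b (b * c) l (b * n + s) (int (b * r + t)) qvar =
      F * (\<Sum>j | j \<le> n \<and> j mod c = r mod c. (-1) ^ (b * j + t) * qvar ^ ((b * j + t) choose 2)
        * gauss qvar (b * n + s) (b * j + t) * H j)"
    unfolding qsumT_eq[OF qvar_power_neq_1] fl poly_cyclotomic_mult[OF assms(5,4) b(1)]
    using b by (subst sum_residue_class_shift[OF b(2,3)])
      (simp_all add: gauss_eq_0 H F_def Q_def del: of_nat_add of_nat_mult)
  have qb: "\<forall>i>0. (qvar ^ b) ^ i \<noteq> 1"
    using qvar_power_neq_1 b by (simp flip: power_mult)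
  have "(qvar ^ b) ^ (c div b) = qvar ^ c" using \<open>b dvd c\<close> by (simp flip: power_mult)
  moreover have "(qvar ^ b) ^ c = Q" by (simp add: Q_def power_mult)
  ultimately have rhs: "qsumT b c l n (int r) (qvar ^ b) =
      F * (\<Sum>j | j \<le> n \<and> j mod c = r mod c. (-1) ^ j * (qvar ^ b) ^ (j choose 2)
        * gauss (qvar ^ b) n j * H j)"
    unfolding qsumT_eq[OF qb] by (simp add: F_def H_def)
  fix z assume z: "z \<in> primitive_roots b"
  have q: "specializes z qvar z" by (rule specializes_qvar)
  have one: "z ^ i = 1" if "b dvd i" for i
    using primitive_roots_power_eq_1_iff[OF z b(1)] that by simp
  have qi: "specializes z (qvar ^ i) 1" if "b dvd i" for i
    using specializes_power[OF q, of i] one[OF that] by simp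
  \<comment> \<open>\<open>Q\<close> differs from 1 as a rational function, though its value at
    \<open>z\<close> is 1.\<close>
  have Q: "specializes z Q 1" "Q \<noteq> 1"
    unfolding Q_def using qi qvar_power_neq_1 b \<open>c > 0\<close> by auto
  \<comment> \<open>The value of \<open>F\<close>: the \<open>q\<close>-factorials turn into
    ordinary factorials, so the denominator is nonzero, and \<open>q ^ b\<close> becomes 1.\<close>
  define w where "w = fact l * poly (map_poly of_int (cyclotomic c)) 1 ^ l
    / (fact (n * b div c) :: complex)"
  have F: "specializes z F w"
    unfolding F_def w_def using qvar_power_neq_1 \<open>c > 0\<close> \<open>b dvd c\<close>
    by (intro specializes_divide specializes_mult specializes_power specializes_qfact
        specializes_poly_of_int Q qi) auto
  define h :: "nat \<Rightarrow> complex"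
    where "h j = (\<Prod>i<l. of_int ((int j - int r) div int c - int i)) / fact l" for j
  have h: "specializes z (H j) (h j)" for j
    unfolding H_def h_def by (rule specializes_qbinom[OF Q])
  have sign: "specializes z ((-1) ^ i) ((-1) ^ i)" for i
    by (intro specializes_power specializes_uminus specializes_1)
  let ?J = "{j. j \<le> n \<and> j mod c = r mod c}"
  define a where "a = (-1) ^ t * z ^ (t choose 2) * gauss z s t"
  \<comment> \<open>The powers of 1 and \<open>gauss 1 n j\<close> stay unsimplified, to match term
    by term what specialising the right-hand side produces.\<close>
  define v where "v = (\<Sum>j\<in>?J. (-1) ^ j * 1 ^ (j choose 2) * gauss 1 n j * h j)"
  have "specializes z (qsumT b (b * c) l (b * n + s) (int (b * r + t)) qvar)
      (w * (\<Sum>j\<in>?J. (-1) ^ (b * j + t) * z ^ ((b * j + t) choose 2)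
        * gauss z (b * n + s) (b * j + t) * h j))"
    unfolding lhs
    by (intro specializes_mult F specializes_sum sign specializes_power q specializes_gauss h)
  also have "(\<Sum>j\<in>?J. (-1) ^ (b * j + t) * z ^ ((b * j + t) choose 2)
        * gauss z (b * n + s) (b * j + t) * h j) = a * v"
    unfolding v_def sum_distrib_left primitive_root_sign[OF z b(1)] q_lucas[OF z b] gauss_1 a_def
    by (intro sum.cong refl) (simp only: power_one mult_1_left mult_1_right mult_ac)
  finally have L: "specializes z (qsumT b (b * c) l (b * n + s) (int (b * r + t)) qvar)
    (w * (a * v))" .
  have "specializes z ((-1) ^ t * qvar ^ (t choose 2) * qbinom qvar (int s) (int t)
      * qsumT b c l n (int r) (qvar ^ b)) (a * (w * v))"
    unfolding rhs a_def v_def qbinom_eq_gauss[OF qvar_power_neq_1]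
    by (intro specializes_mult F specializes_sum sign specializes_power q specializes_gauss h
        qi[of b]) simp_all
  with L show "\<exists>w. specializes z (qsumT b (b * c) l (b * n + s) (int (b * r + t)) qvar) w \<and>
      specializes z ((-1) ^ t * qvar ^ (t choose 2) * qbinom qvar (int s) (int t)
        * qsumT b c l n (int r) (qvar ^ b)) w"
    by (auto simp: mult.left_commute)
qed

end
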